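(* Let $f\in(\mathbb{R}[x])^n$, $G\in(\mathbb{R}[x])^{n\times m}$, and consider the control system $\dot x=f(x)+G(x)u_c$ with $x\in\mathbb{R}^n$, $u_c\in\mathbb{R}^m$. Let $x^*\in\mathbb{R}^n$, let $t\ge 1$, and let $w_1,\dots,w_t\in\mathbb{R}[x]$ be polynomials such that each set $\{x\in\mathbb{R}^n\mid w_i(x)\le 0\}$ is compact. Let $V$ be a polynomial control Lyapunov function (CLF) with respect to $x^*$ and let $B_1,\dots,B_t$ be polynomial control barrier functions (CBFs) for the control system, and suppose that $V,B_1,\dots,B_t$ have the control-sharing property with common controller $u(x)$. If for every $i\in\{1,\dots,t\}$ $$\mathcal X_{s,i}:=\{x\in\mathbb{R}^n\mid B_i(x)\le 0\}\subseteq\{x\in\mathbb{R}^n\mid w_i(x)\le 0\},$$ then for the closed-loop system $\dot x=f(x)+G(x)u(x)$ the point $x^*$ is asymptotically stable, and the closed-loop system is safe with respect to the allowable set $\mathcal X_a=\{x\in\mathbb{R}^n\mid w_i(x)\le 0\ \forall i\in\{1,\dots,t\}\}$ and the safe set $\mathcal X_s=\bigcap_{i=1}^t\mathcal X_{s,i}$.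
   Context: $\mathbb{R}[x]$ denotes the real polynomials in $x\in\mathbb{R}^n$ and $\Sigma[x]$ the set of sum-of-squares (SOS) polynomials, i.e. finite sums of squares of elements of $\mathbb{R}[x]$. CLF: a polynomial $V$ with $V(x^* )=0$, $V(x)>0$ for all $x\ne x^*$, and $\nabla V(x)^Tf(x)<0$ for all $x\ne x^*$ with $\nabla V(x)^TG(x)=0$. Controller associated with a CLF: $u_{CLF}(x)=p(x)/s_1(x)$, where $p\in(\mathbb{R}[x])^m$ and $s_1\in\Sigma[x]$ is strictly positive ($s_1(x)>0$ for all $x$), such that $-s_1\nabla V^Tf-\nabla V^TGp-l^2\in\Sigma[x]$ for a polynomial $l$ with $l(x^* )=0$ and $l(x)\neq0$ for $x\ne x^*$. CBF: a polynomial $B$ with $\{x\mid B(x)\le0\}$ non-empty and $\nabla B(x)^Tf(x)<0$ for all $x$ with $\nabla B(x)^TG(x)=0$ and $B(x)=0$. Controller associated with a CBF $B_i$: $u_{CBF,i}(x)=p(x)/s_1(x)$, where $p\in(\mathbb{R}[x])^m$ and $s_1\in\Sigma[x]$ is strictly positive, such that $-s_1\nabla B_i^Tf-\nabla B_i^TGp-p_{m+1}B_i\in\Sigma[x]$ for some $p_{m+1}\in\mathbb{R}[x]$. (The polynomials $p,s_1,p_{m+1}$ may depend on the function considered.) Control-sharing property with controller $u$: $V$ has an associated controller $u_{CLF}$ and each $B_i$ has an associated controller $u_{CBF,i}$ such that $u(x)=u_{CLF}(x)=u_{CBF,i}(x)$ for all $i$. A set $\mathcal X$ is forward invariant for the closed-loop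 system if for every $x_0\in\mathcal X$ the solution $x(t)$ starting at $x_0$ satisfies $x(t)\in\mathcal X$ for all $t\ge0$. The closed-loop system is safe with respect to an allowable set $\mathcal X_a$ and a safe set $\mathcal X_s$ if $\mathcal X_s$ is forward invariant and $\mathcal X_s\subseteq\mathcal X_a$. *)

theory Defs
  imports "HOL-Analysis.Analysis"
begin

text \<open>
  Since the real field is infinite, polynomials in several real variables are identified with
  the functions they induce: a scalar polynomial is a \<open>real_polynomial_function\<close>, and a vector
  or matrix of polynomials is a \<open>polynomial_function\<close>.
\<close>

definition sos :: "(real ^ 'n \<Rightarrow> real) \<Rightarrow> bool" where
  "sos q \<longleftrightarrow> (\<exists>(k::nat) g. (\<forall>j<k. real_polynomial_function (g j)) \<and>
                       (\<forall>x. q x = (\<Sum>j<k. (g j x)\<^sup>2)))"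

definition grad :: "(real ^ 'n \<Rightarrow> real) \<Rightarrow> real ^ 'n \<Rightarrow> real ^ 'n" where
  "grad V x = (\<chi> i. frechet_derivative V (at x) (axis i 1))"

lemma grad_has_derivative:
  assumes "V differentiable (at x)"
  shows "(V has_derivative (\<lambda>h. grad V x \<bullet> h)) (at x)"
proof -
  have D: "(V has_derivative frechet_derivative V (at x)) (at x)"
    using assms frechet_derivative_works by blast
  then have lin: "linear (frechet_derivative V (at x))"
    by (rule has_derivative_linear)
  have "frechet_derivative V (at x) h = grad V x \<bullet> h" for h
  proof -
    have "frechet_derivative V (at x) h
        = frechet_derivative V (at x) (\<Sum>i\<in>UNIV. (h $ i) *\<^sub>R axis i 1)"
      by (simp add: basis_expansion flip: scalar_mult_eq_scaleR)
    also have "\<dots> = (\<Sum>i\<in>UNIV. (h $ i) * frechet_derivative V (at x) (axis i 1))"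
      by (simp add: linear_sum[OF lin] linear_scale[OF lin])
    also have "\<dots> = grad V x \<bullet> h"
      by (simp add: grad_def inner_vec_def mult.commute)
    finally show ?thesis .
  qed
  then have "frechet_derivative V (at x) = (\<lambda>h. grad V x \<bullet> h)" by blast
  with D show ?thesis by simp
qed

definition is_CLF ::
  "(real ^ 'n \<Rightarrow> real ^ 'n) \<Rightarrow> (real ^ 'n \<Rightarrow> real ^ 'm ^ 'n) \<Rightarrow> real ^ 'n \<Rightarrow> (real ^ 'n \<Rightarrow> real) \<Rightarrow> bool"
where
  "is_CLF f G xs V \<longleftrightarrow>
     real_polynomial_function V \<and> V xs = 0 \<and> (\<forall>x. x \<noteq> xs \<longrightarrow> V x > 0) \<and>
     (\<forall>x. x \<noteq> xs \<and> grad V x v* G x = 0 \<longrightarrow> grad V x \<bullet> f x < 0)"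

definition is_CLF_controller ::
  "(real ^ 'n \<Rightarrow> real ^ 'n) \<Rightarrow> (real ^ 'n \<Rightarrow> real ^ 'm ^ 'n) \<Rightarrow> real ^ 'n \<Rightarrow> (real ^ 'n \<Rightarrow> real) \<Rightarrow>
   (real ^ 'n \<Rightarrow> real ^ 'm) \<Rightarrow> bool"
where
  "is_CLF_controller f G xs V u \<longleftrightarrow>
     (\<exists>p s1 l. polynomial_function p \<and> sos s1 \<and> (\<forall>x. s1 x > 0) \<and>
        real_polynomial_function l \<and> l xs = 0 \<and> (\<forall>x. x \<noteq> xs \<longrightarrow> l x \<noteq> 0) \<and>
        sos (\<lambda>x. - s1 x * (grad V x \<bullet> f x) - grad V x \<bullet> (G x *v p x) - (l x)\<^sup>2) \<and>
        (\<forall>x. u x = p x /\<^sub>R s1 x))"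

definition is_CBF ::
  "(real ^ 'n \<Rightarrow> real ^ 'n) \<Rightarrow> (real ^ 'n \<Rightarrow> real ^ 'm ^ 'n) \<Rightarrow> (real ^ 'n \<Rightarrow> real) \<Rightarrow> bool"
where
  "is_CBF f G B \<longleftrightarrow>
     real_polynomial_function B \<and> {x. B x \<le> 0} \<noteq> {} \<and>
     (\<forall>x. grad B x v* G x = 0 \<and> B x = 0 \<longrightarrow> grad B x \<bullet> f x < 0)"

definition is_CBF_controller ::
  "(real ^ 'n \<Rightarrow> real ^ 'n) \<Rightarrow> (real ^ 'n \<Rightarrow> real ^ 'm ^ 'n) \<Rightarrow> (real ^ 'n \<Rightarrow> real) \<Rightarrow>
   (real ^ 'n \<Rightarrow> real ^ 'm) \<Rightarrow> bool"
where
  "is_CBF_controller f G B u \<longleftrightarrow>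
     (\<exists>p s1 q. polynomial_function p \<and> sos s1 \<and> (\<forall>x. s1 x > 0) \<and>
        real_polynomial_function q \<and>
        sos (\<lambda>x. - s1 x * (grad B x \<bullet> f x) - grad B x \<bullet> (G x *v p x) - q x * B x) \<and>
        (\<forall>x. u x = p x /\<^sub>R s1 x))"

text \<open>
  The polynomials witnessing that \<open>u\<close> is a controller may differ between \<open>V\<close> and the \<open>B i\<close>;
  only their quotient \<open>u\<close> is shared.
\<close>

definition control_sharing ::
  "(real ^ 'n \<Rightarrow> real ^ 'n) \<Rightarrow> (real ^ 'n \<Rightarrow> real ^ 'm ^ 'n) \<Rightarrow> real ^ 'n \<Rightarrow> (real ^ 'n \<Rightarrow> real) \<Rightarrow>
   nat \<Rightarrow> (nat \<Rightarrow> real ^ 'n \<Rightarrow> real) \<Rightarrow> (real ^ 'n \<Rightarrow> real ^ 'm) \<Rightarrow> bool"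
where
  "control_sharing f G xs V t B u \<longleftrightarrow>
     is_CLF_controller f G xs V u \<and> (\<forall>i\<in>{1..t}. is_CBF_controller f G (B i) u)"

definition closed_loop ::
  "(real ^ 'n \<Rightarrow> real ^ 'n) \<Rightarrow> (real ^ 'n \<Rightarrow> real ^ 'm ^ 'n) \<Rightarrow> (real ^ 'n \<Rightarrow> real ^ 'm) \<Rightarrow>
   real ^ 'n \<Rightarrow> real ^ 'n"
where
  "closed_loop f G u x = f x + G x *v u x"

definition solution_from ::
  "(real ^ 'n \<Rightarrow> real ^ 'n) \<Rightarrow> real ^ 'n \<Rightarrow> (real \<Rightarrow> real ^ 'n) \<Rightarrow> bool"
where
  "solution_from F x0 x \<longleftrightarrow>
     x 0 = x0 \<and> (\<forall>\<tau>\<ge>0. (x has_vector_derivative F (x \<tau>)) (at \<tau> within {0..}))"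

text \<open>
  ``The solution starting at \<open>x0\<close> satisfies \<open>P\<close>'' includes the existence of a solution for all
  nonnegative times, so that finite escape time is excluded rather than ignored.
\<close>

definition solution_satisfies ::
  "(real ^ 'n \<Rightarrow> real ^ 'n) \<Rightarrow> real ^ 'n \<Rightarrow> ((real \<Rightarrow> real ^ 'n) \<Rightarrow> bool) \<Rightarrow> bool"
where
  "solution_satisfies F x0 P \<longleftrightarrow>
     (\<exists>x. solution_from F x0 x) \<and> (\<forall>x. solution_from F x0 x \<longrightarrow> P x)"

definition forward_invariant :: "(real ^ 'n \<Rightarrow> real ^ 'n) \<Rightarrow> (real ^ 'n) set \<Rightarrow> bool" where
  "forward_invariant F X \<longleftrightarrow>
     (\<forall>x0\<in>X. solution_satisfies F x0 (\<lambda>x. \<forall>\<tau>\<ge>0. x \<tau> \<in> X))"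

definition safe :: "(real ^ 'n \<Rightarrow> real ^ 'n) \<Rightarrow> (real ^ 'n) set \<Rightarrow> (real ^ 'n) set \<Rightarrow> bool" where
  "safe F Xa Xs \<longleftrightarrow> forward_invariant F Xs \<and> Xs \<subseteq> Xa"

text \<open>
  Asymptotic stability is the usual local notion: an equilibrium that is stable in the sense of
  Lyapunov and attracts all solutions starting close to it.
\<close>

definition lyapunov_stable :: "(real ^ 'n \<Rightarrow> real ^ 'n) \<Rightarrow> real ^ 'n \<Rightarrow> bool" where
  "lyapunov_stable F xs \<longleftrightarrow>
     (\<forall>\<epsilon>>0. \<exists>\<delta>>0. \<forall>x0. dist x0 xs < \<delta> \<longrightarrow>
        solution_satisfies F x0 (\<lambda>x. \<forall>\<tau>\<ge>0. dist (x \<tau>) xs < \<epsilon>))"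

definition asymptotically_stable :: "(real ^ 'n \<Rightarrow> real ^ 'n) \<Rightarrow> real ^ 'n \<Rightarrow> bool" where
  "asymptotically_stable F xs \<longleftrightarrow>
     F xs = 0 \<and> lyapunov_stable F xs \<and>
     (\<exists>\<delta>>0. \<forall>x0. dist x0 xs < \<delta> \<longrightarrow>
        solution_satisfies F x0 (\<lambda>x. (x \<longlongrightarrow> xs) at_top))"

end

theory Submission
  imports Defs
begin

text \<open>
  Write \<open>F = f + G u\<close>. Dividing the two sum-of-squares certificates by their positive
  denominators turns them into pointwise differential inequalities,
  \<open>\<nabla>V \<bullet> F \<le> - l\<^sup>2 / s\<close> and \<open>\<nabla>B\<^sub>i \<bullet> F \<le> - c\<^sub>i B\<^sub>i\<close> with continuous \<open>c\<^sub>i\<close>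
  (\<open>closed_loop_lie_derivative\<close>).

  The first one makes \<open>V\<close> a strict Lyapunov function, and the classical argument gives stability
  and attraction. That \<open>x\<^sup>*\<close> is an equilibrium comes out of the same inequality: a solution
  starting at \<open>x\<^sup>*\<close> has \<open>V \<le> 0\<close> forever, so it never leaves \<open>x\<^sup>*\<close>
  (locale \<open>strict_lyapunov\<close>).
  The second one keeps \<open>B\<^sub>i\<close> nonpositive along any solution on which it starts nonpositive:
  the integrating factor \<open>exp (\<integral> c\<^sub>i)\<close> makes \<open>B\<^sub>i\<close> times it nonincreasing
  (\<open>barrier_nonpos\<close>).

  What remains is that solutions exist for all nonnegative times. In both cases the inequalities
  show that any solution piece stays in a compact set, namely a ball around \<open>x\<^sup>*\<close>
  respectively the safe set, which is closed and contained in a compact \<open>{x. w\<^sub>i x \<le> 0}\<close>. Since \<open>F\<close>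
  is a quotient of polynomials with positive denominator, it is Lipschitz on balls; composed with
  the projection onto a large ball it becomes bounded and globally Lipschitz. The modified equation
  has a global solution (\<open>global_solution_of_bounded_lipschitz\<close>), and confinement prevents that
  solution from reaching the region where the equation was modified
  (\<open>confined_solution_exists\<close>). The estimates hold along every solution, so they locate all
  solutions with the given initial value and not just the one that was constructed.
\<close>

section \<open>Global solutions of ordinary differential equations\<close>

lemma has_vector_derivative_integral_half_line:
  fixes h :: "real \<Rightarrow> 'a::banach"
  assumes h: "continuous_on UNIV h" and t: "0 \<le> t"
  shows "((\<lambda>u. integral {0..u} h) has_vector_derivative h t) (at t within {0..})"
proof -
  have "((\<lambda>u. integral {0..u} h) has_vector_derivative h t) (at t within {0..t + 1})"
    using continuous_on_subset[OF h] t by (intro integral_has_vector_derivative) auto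
  moreover have "at t within {0..t + 1} = at t within {0..}"
    by (rule at_within_nhd[of _ "{..<t + 1}"]) auto
  ultimately show ?thesis by simp
qed

text \<open>
  Picard's integral operator, made a contraction on the whole half-line by an exponential weight:
  the unknown is \<open>y t = exp (- 2 l t) (x t - x0)\<close>, which is bounded because \<open>F\<close> is, and integrating
  the Lipschitz estimate against the weight \<open>exp (2 l t)\<close> produces the contraction factor
  \<open>l / (2 l) = 1 / 2\<close>.
\<close>
theorem global_solution_of_bounded_lipschitz:
  fixes F :: "'a::banach \<Rightarrow> 'a"
  assumes lip: "L-lipschitz_on UNIV F" and bnd: "\<And>x. norm (F x) \<le> M"
  shows "\<exists>x. x 0 = x0 \<and> (\<forall>t\<ge>0. (x has_vector_derivative F (x t)) (at t within {0..}))"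
proof -
  \<comment> \<open>The Lipschitz constant is increased so that one may divide by it.\<close>
  define l where "l = L + 1"
  have l: "l > 0" and Ll: "L \<le> l"
    using lipschitz_on_nonneg[OF lip] by (auto simp: l_def)
  have F_lip: "norm (F a - F b) \<le> l * norm (a - b)" for a b
    using lipschitz_onD[OF lip, of a b] Ll mult_right_mono[OF Ll, of "dist a b"]
    by (simp add: dist_norm)
  have F_cont: "continuous_on UNIV F"
    by (rule lipschitz_on_continuous_on[OF lip])
  have M: "0 \<le> M" using bnd[of 0] norm_ge_zero order_trans by blast
  \<comment> \<open>Bounded continuous functions live on the whole line here; \<open>max t 0\<close> extends the operator
      constantly to negative times.\<close>
  define X where "X y s = x0 + exp (2 * l * s) *\<^sub>R y s" for y :: "real \<Rightarrow> 'a" and s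
  define \<Phi> where "\<Phi> y t = exp (- 2 * l * max t 0) *\<^sub>R integral {0..max t 0} (\<lambda>s. F (X y s))"
    for y t
  have X_cont: "continuous_on UNIV (X y)" if "continuous_on UNIV y" for y
    unfolding X_def by (intro continuous_intros that)
  have FX_cont: "continuous_on S (\<lambda>s. F (X y s))" if "continuous_on UNIV y" for y S
    by (rule continuous_on_subset[OF continuous_on_compose2[OF F_cont X_cont[OF that]]]) auto
  have \<Phi>_cont: "continuous_on UNIV (\<Phi> y)" if y: "continuous_on UNIV y" for y
  proof -
    have "continuous_on {0..} (\<lambda>u. integral {0..u} (\<lambda>s. F (X y s)))"
      using has_vector_derivative_integral_half_line[OF FX_cont[OF y]]
      by (auto simp: continuous_on_eq_continuous_within intro: has_vector_derivative_continuous)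
    then have "continuous_on UNIV (\<lambda>t. integral {0..max t 0} (\<lambda>s. F (X y s)))"
      by (rule continuous_on_compose2) (auto intro!: continuous_intros)
    then show ?thesis unfolding \<Phi>_def by (intro continuous_intros)
  qed
  have \<Phi>_bnd: "norm (\<Phi> y t) \<le> M / (2 * l)" if y: "continuous_on UNIV y" for y t
  proof -
    define m where "m = max t 0"
    have m: "0 \<le> m" by (simp add: m_def)
    have "norm (integral {0..m} (\<lambda>s. F (X y s))) \<le> integral {0..m} (\<lambda>s. M)"
      by (intro integral_norm_bound_integral integrable_continuous_real FX_cont y bnd) auto
    also have "\<dots> = m * M" using m by simp
    finally have "norm (\<Phi> y t) \<le> exp (- 2 * l * m) * (m * M)"
      by (simp add: \<Phi>_def m_def[symmetric])
    moreover have "2 * l * m \<le> exp (2 * l * m)"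
      using exp_ge_add_one_self[of "2 * l * m"] by linarith
    then have "exp (- 2 * l * m) * m \<le> 1 / (2 * l)"
      using l by (simp add: exp_minus field_simps)
    from mult_right_mono[OF this M] have "exp (- 2 * l * m) * (m * M) \<le> M / (2 * l)"
      by (simp add: mult.assoc)
    ultimately show ?thesis by linarith
  qed
  define T where "T y = Bcontfun (\<Phi> (apply_bcontfun y))" for y
  have cont: "continuous_on S (apply_bcontfun y)" for S y
    by (rule continuous_on_apply_bcontfun)
  have T_apply: "apply_bcontfun (T y) = \<Phi> (apply_bcontfun y)" for y
    unfolding T_def
    by (intro Bcontfun_inverse bcontfun_normI[of _ "M / (2 * l)"] \<Phi>_cont \<Phi>_bnd cont)
  have contr: "dist (T y) (T z) \<le> 1 / 2 * dist y z" for y z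
  proof (rule dist_bound)
    fix t :: real
    define m where "m = max t 0"
    have m: "0 \<le> m" by (simp add: m_def)
    define d where "d = dist y z"
    have pointwise: "norm (F (X y s) - F (X z s)) \<le> l * d * exp (2 * l * s)" for s
    proof -
      have "norm (F (X y s) - F (X z s)) \<le> l * norm (X y s - X z s)" by (rule F_lip)
      also have "norm (X y s - X z s) = exp (2 * l * s) * dist (y s) (z s)"
        by (simp add: X_def dist_norm flip: scaleR_diff_right)
      also have "l * \<dots> \<le> l * (exp (2 * l * s) * d)"
        using l dist_bounded[of y s z] by (auto simp: d_def)
      finally show ?thesis by (simp add: mult_ac)
    qed
    have "((\<lambda>s. l * d * exp (2 * l * s)) has_integral
            d / 2 * exp (2 * l * m) - d / 2 * exp (2 * l * 0)) {0..m}"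
      using l m by (intro fundamental_theorem_of_calculus)
        (auto intro!: derivative_eq_intros simp flip: has_real_derivative_iff_has_vector_derivative)
    then have "integral {0..m} (\<lambda>s. l * d * exp (2 * l * s))
        = d / 2 * exp (2 * l * m) - d / 2 * exp (2 * l * 0)"
      by (rule integral_unique)
    also have "\<dots> = d / 2 * (exp (2 * l * m) - 1)" by (simp add: algebra_simps)
    finally have int: "integral {0..m} (\<lambda>s. l * d * exp (2 * l * s))
        = d / 2 * (exp (2 * l * m) - 1)" .
    have "norm (integral {0..m} (\<lambda>s. F (X y s) - F (X z s)))
        \<le> integral {0..m} (\<lambda>s. l * d * exp (2 * l * s))"
      by (intro integral_norm_bound_integral integrable_continuous_real continuous_on_diff
          FX_cont cont pointwise continuous_intros)
    also have "integral {0..m} (\<lambda>s. F (X y s) - F (X z s))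
        = integral {0..m} (\<lambda>s. F (X y s)) - integral {0..m} (\<lambda>s. F (X z s))"
      by (intro integral_diff integrable_continuous_real FX_cont cont)
    finally have "norm (integral {0..m} (\<lambda>s. F (X y s)) - integral {0..m} (\<lambda>s. F (X z s)))
        \<le> d / 2 * (exp (2 * l * m) - 1)"
      unfolding int .
    then have "exp (- 2 * l * m) * norm (integral {0..m} (\<lambda>s. F (X y s))
          - integral {0..m} (\<lambda>s. F (X z s)))
        \<le> exp (- 2 * l * m) * (d / 2 * (exp (2 * l * m) - 1))"
      by (rule mult_left_mono) simp
    then have "dist (T y t) (T z t) \<le> exp (- 2 * l * m) * (d / 2 * (exp (2 * l * m) - 1))"
      by (simp add: T_apply \<Phi>_def m_def[symmetric] dist_norm flip: scaleR_diff_right)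
    also have "\<dots> = d / 2 * (1 - exp (- 2 * l * m))"
      by (simp add: exp_minus field_simps)
    also have "\<dots> \<le> 1 / 2 * d"
      using mult_left_mono[of "1 - exp (- 2 * l * m)" 1 "d / 2"] by (simp add: d_def)
    finally show "dist (T y t) (T z t) \<le> 1 / 2 * dist y z" by (simp add: d_def)
  qed
  then obtain y where fix_T: "T y = y"
    using banach_fix_type[of "1 / 2" T] by auto
  have y: "apply_bcontfun y = \<Phi> y"
    using T_apply[of y] by (simp add: fix_T)
  have X_eq: "X y t = x0 + integral {0..t} (\<lambda>s. F (X y s))" if "0 \<le> t" for t
  proof -
    have "X y t = x0 + exp (2 * l * t) *\<^sub>R \<Phi> y t" unfolding X_def using y by metis
    then show ?thesis using that by (simp add: \<Phi>_def flip: exp_add)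
  qed
  have "(X y has_vector_derivative F (X y t)) (at t within {0..})" if t: "0 \<le> t" for t
  proof -
    have "((\<lambda>u. x0 + integral {0..u} (\<lambda>s. F (X y s))) has_vector_derivative F (X y t))
        (at t within {0..})"
      using has_vector_derivative_add[OF has_vector_derivative_const
          has_vector_derivative_integral_half_line[OF FX_cont[OF cont] t]] by simp
    then show ?thesis
      by (rule has_vector_derivative_transform[rotated 2]) (use t in \<open>auto simp: X_eq\<close>)
  qed
  moreover have "X y 0 = x0" using X_eq[of 0] by simp
  ultimately show ?thesis by blast
qed

text \<open>
  Confinement arguments run along a solution before it is known to exist forever, hence this local
  version of \<open>solution_from\<close>, without an initial condition.
\<close>
definition solution_upto :: "real \<Rightarrow> ('a::real_normed_vector \<Rightarrow> 'a) \<Rightarrow> (real \<Rightarrow> 'a) \<Rightarrow> bool" where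
  "solution_upto T F x \<longleftrightarrow>
     (\<forall>\<tau>\<in>{0..T}. (x has_vector_derivative F (x \<tau>)) (at \<tau> within {0..T}))"

lemma solution_upto_continuous:
  assumes "solution_upto T F x"
  shows "continuous_on {0..T} x"
  using assms unfolding solution_upto_def continuous_on_eq_continuous_within
  by (blast intro: has_vector_derivative_continuous)

lemma solution_upto_if_solution_from:
  assumes "solution_from F x0 x"
  shows "solution_upto T F x"
  using assms unfolding solution_from_def solution_upto_def
  by (auto intro!: has_vector_derivative_within_subset[where S = "{0..}" and T = "{0..T}"])

text \<open>The equation is autonomous, so solutions can be restarted at any later time.\<close>
lemma solution_from_shift:
  fixes F :: "real ^ 'n \<Rightarrow> real ^ 'n"
  assumes x: "solution_from F x0 x" and T: "0 \<le> T"
  shows "solution_from F (x T) (\<lambda>\<tau>. x (T + \<tau>))"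
  unfolding solution_from_def
proof (intro conjI allI impI)
  show "x (T + 0) = x T" by simp
  fix \<tau> :: real assume \<tau>: "0 \<le> \<tau>"
  have "(x has_vector_derivative F (x (T + \<tau>))) (at (T + \<tau>) within (+) T ` {0..})"
    using x T \<tau> unfolding solution_from_def
    by (auto intro!: has_vector_derivative_within_subset[where S = "{0..}" and T = "{T..}"])
  moreover have "((+) T has_vector_derivative 1) (at \<tau> within {0..})"
    by (auto intro!: derivative_eq_intros)
  ultimately have "(x \<circ> (+) T has_vector_derivative 1 *\<^sub>R F (x (T + \<tau>))) (at \<tau> within {0..})"
    by (intro vector_diff_chain_within) auto
  then show "((\<lambda>\<tau>. x (T + \<tau>)) has_vector_derivative F (x (T + \<tau>))) (at \<tau> within {0..})"
    by (simp add: o_def)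
qed

text \<open>
  An a priori bound excludes finite escape time. Choose a ball \<open>C\<close> with \<open>K\<close> in its interior and
  replace \<open>F x\<close> by \<open>F\<close> at the point of \<open>C\<close> closest to \<open>x\<close>. As long as a solution of the modified
  equation is in \<open>C\<close> it solves the original equation, hence lies in \<open>K\<close>, so at a first time of
  reaching the boundary of \<open>C\<close> it would be both in \<open>K\<close> and outside the interior of \<open>C\<close>.
\<close>
theorem confined_solution_exists:
  fixes F :: "real ^ 'n \<Rightarrow> real ^ 'n"
  assumes lip: "\<And>R. \<exists>L. L-lipschitz_on (cball 0 R) F"
    and K: "compact K"
    and confined: "\<And>T x. \<lbrakk>0 \<le> T; x 0 = x0; solution_upto T F x\<rbrakk> \<Longrightarrow> x T \<in> K"
  shows "\<exists>x. solution_from F x0 x"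
proof -
  obtain R where R: "0 < R" "K \<subseteq> ball 0 R"
    using bounded_subset_ballD[OF compact_imp_bounded[OF K]] by blast
  define C where "C = (cball 0 R :: (real ^ 'n) set)"
  have C: "compact C" "convex C" "closed C" "C \<noteq> {}"
    using R by (auto simp: C_def)
  obtain L where L: "L-lipschitz_on C F" using lip C_def by blast
  have proj_in: "closest_point C x \<in> C" for x
    using C by (simp add: closest_point_in_set)
  have "bounded (F ` C)"
    by (intro compact_imp_bounded compact_continuous_image lipschitz_on_continuous_on[OF L] C)
  then obtain M where "\<And>y. y \<in> C \<Longrightarrow> norm (F y) \<le> M" by (auto simp: bounded_iff)
  then have bnd: "norm (F (closest_point C x)) \<le> M" for x using proj_in by blast
  have "L-lipschitz_on UNIV (\<lambda>x. F (closest_point C x))"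
  proof (rule lipschitz_onI)
    show "0 \<le> L" by (rule lipschitz_on_nonneg[OF L])
    show "dist (F (closest_point C x)) (F (closest_point C y)) \<le> L * dist x y" for x y
      using lipschitz_onD[OF L proj_in proj_in]
        mult_left_mono[OF closest_point_lipschitz[OF C(2-4)] lipschitz_on_nonneg[OF L]]
      by (rule order_trans)
  qed
  from global_solution_of_bounded_lipschitz[OF this bnd]
  obtain x where x0: "x 0 = x0"
    and x: "\<And>\<tau>. 0 \<le> \<tau> \<Longrightarrow>
      (x has_vector_derivative F (closest_point C (x \<tau>))) (at \<tau> within {0..})"
    by blast
  have x_cont: "continuous_on {0..} x"
    using x unfolding continuous_on_eq_continuous_within
    by (auto intro: has_vector_derivative_continuous)
  have true_solution: "solution_upto T F x" if "\<And>\<tau>. \<tau> \<in> {0..T} \<Longrightarrow> x \<tau> \<in> C" for T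
    unfolding solution_upto_def
  proof
    fix \<tau> assume \<tau>: "\<tau> \<in> {0..T}"
    have "(x has_vector_derivative F (closest_point C (x \<tau>))) (at \<tau> within {0..T})"
      by (rule has_vector_derivative_within_subset[OF x]) (use \<tau> in auto)
    then show "(x has_vector_derivative F (x \<tau>)) (at \<tau> within {0..T})"
      by (simp add: closest_point_self[OF that[OF \<tau>]])
  qed
  have inside: "x \<tau> \<in> ball 0 R" if "0 \<le> \<tau>" for \<tau>
  proof (rule ccontr)
    assume out: "x \<tau> \<notin> ball 0 R"
    define S where "S = {0..} \<inter> x -` (- ball 0 R)"
    have S: "closed S" "S \<noteq> {}" "bdd_below S"
      using continuous_on_closed_vimage[of "{0::real..}" x] x_cont out that
      by (auto simp: S_def bdd_below_def Int_commute intro!: continuous_closed_preimage)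
    \<comment> \<open>The first exit time.\<close>
    define T where "T = Inf S"
    have "T \<in> S" unfolding T_def by (rule closed_contains_Inf[OF S(2,3,1)])
    then have T: "0 \<le> T" "x T \<notin> ball 0 R" by (auto simp: S_def)
    have before: "norm (x s) \<le> R" if "s \<in> {0..<T}" for s
    proof -
      have "s \<notin> S" using that cInf_lower[OF _ S(3)] by (force simp: T_def)
      with that show ?thesis by (auto simp: S_def)
    qed
    have "x s \<in> C" if s: "s \<in> {0..T}" for s
    proof (cases "T = 0")
      case True
      \<comment> \<open>On the one-point interval every curve is a solution, so confinement gives \<open>x0 \<in> K\<close>.\<close>
      have "x 0 \<in> K"
        by (rule confined[of 0 x])
          (auto simp: x0 solution_upto_def has_vector_derivative_def has_derivative_def
            bounded_linear_scaleR_left at_within_def)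
      then show ?thesis using True s R by (auto simp: C_def)
    next
      case False
      then have cl: "closure {0..<T} = {0..T}" using T by (simp add: closure_atLeastLessThan)
      have "norm (x s) \<le> R"
        by (rule continuous_on_closure_norm_le[of "{0..<T}"])
          (use s before in \<open>auto simp: cl intro: continuous_on_subset[OF x_cont]\<close>)
      then show ?thesis by (simp add: C_def)
    qed
    then have "x T \<in> K" using true_solution confined x0 T(1) by blast
    with R T show False by blast
  qed
  have "(x has_vector_derivative F (x \<tau>)) (at \<tau> within {0..})" if "0 \<le> \<tau>" for \<tau>
  proof -
    have "x \<tau> \<in> C" using inside[OF that] by (simp add: C_def)
    then show ?thesis using x[OF that] by (simp add: closest_point_self)
  qed
  with x0 show ?thesis unfolding solution_from_def by blast
qed

section \<open>Differential inequalities along solutions\<close>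

lemma has_real_derivative_along_curve:
  assumes V: "V differentiable at (x \<tau>)"
    and x: "(x has_vector_derivative v) (at \<tau> within S)"
  shows "((\<lambda>s. V (x s)) has_real_derivative grad V (x \<tau>) \<bullet> v) (at \<tau> within S)"
proof -
  have "((\<lambda>s. V (x s)) has_derivative (\<lambda>h. grad V (x \<tau>) \<bullet> (h *\<^sub>R v))) (at \<tau> within S)"
    using has_derivative_compose[OF x[unfolded has_vector_derivative_def]
        grad_has_derivative[OF V]] .
  then show ?thesis
    by (simp add: has_field_derivative_def mult.commute[of _ "grad V (x \<tau>) \<bullet> v"])
qed

lemma le_initial_if_derivative_nonpos:
  fixes g :: "real \<Rightarrow> real"
  assumes "0 \<le> T"
    and der: "\<And>\<tau>. \<tau> \<in> {0..T} \<Longrightarrow> (g has_real_derivative g' \<tau>) (at \<tau> within {0..T})"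
    and nonpos: "\<And>\<tau>. \<tau> \<in> {0..T} \<Longrightarrow> g' \<tau> \<le> 0"
  shows "g T \<le> g 0"
proof (rule DERIV_nonpos_imp_decreasing_open[OF \<open>0 \<le> T\<close>])
  show "\<exists>y. DERIV g \<tau> :> y \<and> y \<le> 0" if "0 < \<tau>" "\<tau> < T" for \<tau>
    using der[of \<tau>] nonpos[of \<tau>] that by (auto simp: at_within_Icc_at)
  show "continuous_on {0..T} g"
    unfolding continuous_on_eq_continuous_within using der DERIV_continuous by blast
qed

section \<open>Strict Lyapunov functions\<close>

text \<open>
  The sublevel sets of \<open>V\<close> may be unbounded, so the conclusions are local. The strict decrease is
  recorded through a continuous bound \<open>W\<close> so that it is uniform on compact sets away from \<open>z\<close>.
\<close>
locale strict_lyapunov =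
  fixes F :: "real ^ 'n \<Rightarrow> real ^ 'n" and z :: "real ^ 'n"
    and V W :: "real ^ 'n \<Rightarrow> real"
  assumes F_lipschitz: "\<And>R. \<exists>L. L-lipschitz_on (cball 0 R) F"
    and V_differentiable: "\<And>y. V differentiable at y"
    and V_zero: "V z = 0"
    and V_pos: "\<And>y. y \<noteq> z \<Longrightarrow> 0 < V y"
    and W_continuous: "continuous_on UNIV W"
    and W_nonneg: "\<And>y. 0 \<le> W y"
    and W_pos: "\<And>y. y \<noteq> z \<Longrightarrow> 0 < W y"
    and decrease: "\<And>y. grad V y \<bullet> F y \<le> - W y"
begin

lemma V_continuous: "continuous_on S V"
  using V_differentiable
  by (meson continuous_at_imp_continuous_on differentiable_imp_continuous_within)

lemma V_along_solution:
  assumes "solution_upto T F x" "\<tau> \<in> {0..T}"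
  shows "((\<lambda>s. V (x s)) has_real_derivative grad V (x \<tau>) \<bullet> F (x \<tau>)) (at \<tau> within {0..T})"
  using assms by (intro has_real_derivative_along_curve V_differentiable)
    (auto simp: solution_upto_def)

lemma V_le_initial:
  assumes "solution_upto T F x" "0 \<le> T"
  shows "V (x T) \<le> V (x 0)"
  using assms(2) V_along_solution[OF assms(1)]
proof (rule le_initial_if_derivative_nonpos)
  show "grad V (x \<tau>) \<bullet> F (x \<tau>) \<le> 0" for \<tau>
    using decrease[of "x \<tau>"] W_nonneg[of "x \<tau>"] by linarith
qed

text \<open>
  To leave the ball a curve must meet the sphere, where \<open>V\<close> is at least its positive minimum; but
  \<open>V\<close> started below that minimum and does not increase. This is stated for solutions on finite
  intervals because it also has to provide the confinement from which global existence follows.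
\<close>
lemma stays_in_ball:
  assumes "0 < \<epsilon>"
  shows "\<exists>\<delta>>0. \<forall>x0 T x. dist x0 z < \<delta> \<longrightarrow> 0 \<le> T \<longrightarrow> x 0 = x0 \<longrightarrow> solution_upto T F x \<longrightarrow>
           dist (x T) z < \<epsilon>"
proof -
  obtain y where y: "y \<in> sphere z \<epsilon>" and y_min: "\<And>v. v \<in> sphere z \<epsilon> \<Longrightarrow> V y \<le> V v"
    using continuous_attains_inf[of "sphere z \<epsilon>" V] V_continuous assms by auto
  have "0 < V y" using V_pos[of y] y assms by auto
  moreover have "isCont V z"
    using V_continuous[of UNIV] by (simp add: continuous_on_eq_continuous_at)
  ultimately obtain \<delta> where \<delta>: "0 < \<delta>" "\<And>v. dist v z < \<delta> \<Longrightarrow> V v < V y"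
    unfolding continuous_at_eps_delta by (force simp: V_zero dist_real_def)
  have "dist (x T) z < \<epsilon>"
    if start: "dist (x 0) z < min \<delta> \<epsilon>" and T: "0 \<le> T" and x: "solution_upto T F x" for T x
  proof (rule ccontr)
    assume "\<not> dist (x T) z < \<epsilon>"
    have "connected (x ` {0..T})"
      by (intro connected_continuous_image solution_upto_continuous[OF x] connected_Icc)
    moreover have "x 0 \<in> x ` {0..T} \<inter> ball z \<epsilon>" "x T \<in> x ` {0..T} - ball z \<epsilon>"
      using start T \<open>\<not> dist (x T) z < \<epsilon>\<close> by (simp_all add: dist_commute)
    ultimately have "x ` {0..T} \<inter> frontier (ball z \<epsilon>) \<noteq> {}"
      using connected_Int_frontier by blast
    then obtain s where s: "s \<in> {0..T}" "x s \<in> sphere z \<epsilon>"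
      unfolding frontier_ball[OF assms] by blast
    have "solution_upto s F x"
      using x s unfolding solution_upto_def
      by (auto intro!: has_vector_derivative_within_subset[where S = "{0..T}" and T = "{0..s}"])
    then have "V (x s) \<le> V (x 0)" using V_le_initial s by auto
    with \<delta>(2)[of "x 0"] y_min[OF s(2)] start show False by simp
  qed
  moreover have "0 < min \<delta> \<epsilon>" using \<delta> assms by simp
  ultimately show ?thesis by blast
qed

lemma lyapunov_stable: "lyapunov_stable F z"
  unfolding lyapunov_stable_def
proof (intro allI impI)
  fix \<epsilon> :: real assume "0 < \<epsilon>"
  from stays_in_ball[OF this] obtain \<delta> where "0 < \<delta>"
    and \<delta>: "\<And>T x. dist (x 0) z < \<delta> \<Longrightarrow> 0 \<le> T \<Longrightarrow> solution_upto T F x \<Longrightarrow> dist (x T) z < \<epsilon>"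
    by blast
  have "solution_satisfies F x0 (\<lambda>x. \<forall>\<tau>\<ge>0. dist (x \<tau>) z < \<epsilon>)" if x0: "dist x0 z < \<delta>" for x0
    unfolding solution_satisfies_def
  proof (intro conjI allI impI)
    show "\<exists>x. solution_from F x0 x"
      by (rule confined_solution_exists[OF F_lipschitz, of "cball z \<epsilon>"])
        (use \<delta> x0 in \<open>auto simp: dist_commute intro: less_imp_le\<close>)
    show "dist (x \<tau>) z < \<epsilon>" if "solution_from F x0 x" "0 \<le> \<tau>" for x \<tau>
      using \<delta>[of x \<tau>] that x0 solution_upto_if_solution_from[OF that(1)]
      by (auto simp: solution_from_def)
  qed
  with \<open>0 < \<delta>\<close> show "\<exists>\<delta>>0. \<forall>x0. dist x0 z < \<delta> \<longrightarrow>
      solution_satisfies F x0 (\<lambda>x. \<forall>\<tau>\<ge>0. dist (x \<tau>) z < \<epsilon>)" by blast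
qed

text \<open>
  \<open>V\<close> vanishes only at \<open>z\<close> and cannot grow, so a solution starting at \<open>z\<close> is constant, and its
  velocity there is \<open>F z\<close>.
\<close>
lemma equilibrium: "F z = 0"
proof -
  obtain x where x: "solution_from F z x"
    using lyapunov_stable unfolding lyapunov_stable_def solution_satisfies_def
    by (metis dist_self zero_less_one)
  then have x0: "x 0 = z" by (simp add: solution_from_def)
  have "x \<tau> = z" if "0 \<le> \<tau>" for \<tau>
    using V_le_initial[OF solution_upto_if_solution_from[OF x] that] V_pos[of "x \<tau>"]
    by (auto simp: x0 V_zero)
  then have "(x has_vector_derivative 0) (at 0 within {0..})"
    by (intro has_vector_derivative_transform[OF _ _ has_vector_derivative_const[of z]]) auto
  moreover have "(x has_vector_derivative F z) (at 0 within {0..})"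
    using x x0 unfolding solution_from_def by force
  moreover have "at (0::real) within {0..} \<noteq> bot"
  proof -
    have "{0<..} \<subseteq> {0::real..}" by auto
    from at_le[OF this, of 0] show ?thesis
      using trivial_limit_at_right_real[of "0::real"] by (auto simp: bot_unique)
  qed
  ultimately show ?thesis using vector_derivative_unique_within by blast
qed

text \<open>
  A bounded solution avoiding the \<open>\<delta>\<close>-ball stays in a compact annulus, on which \<open>W\<close> has a positive
  minimum; \<open>V\<close> would then decrease at least linearly and become negative.
\<close>
lemma visits_neighbourhood:
  assumes x: "solution_from F x0 x" and bounded: "\<And>\<tau>. 0 \<le> \<tau> \<Longrightarrow> dist (x \<tau>) z \<le> r"
    and \<delta>: "0 < \<delta>"
  shows "\<exists>\<tau>\<ge>0. dist (x \<tau>) z < \<delta>"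
proof (rule ccontr)
  assume far: "\<not> ?thesis"
  define K where "K = cball z r - ball z \<delta>"
  have in_K: "x \<tau> \<in> K" if "0 \<le> \<tau>" for \<tau>
    using far bounded that by (auto simp: K_def dist_commute)
  have "compact K" by (simp add: K_def compact_diff)
  then obtain y where y: "y \<in> K" and y_min: "\<And>v. v \<in> K \<Longrightarrow> W y \<le> W v"
    using continuous_attains_inf[of K W] in_K[of 0] continuous_on_subset[OF W_continuous] by auto
  have pos: "0 < W y"
    by (rule W_pos) (use y \<delta> in \<open>auto simp: K_def\<close>)
  have bound: "V (x T) + W y * T \<le> V (x 0) + W y * 0" if T: "0 \<le> T" for T
  proof (rule le_initial_if_derivative_nonpos[OF T])
    fix \<tau> assume \<tau>: "\<tau> \<in> {0..T}"
    from V_along_solution[OF solution_upto_if_solution_from[OF x] \<tau>]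
    show "((\<lambda>s. V (x s) + W y * s) has_real_derivative grad V (x \<tau>) \<bullet> F (x \<tau>) + W y)
        (at \<tau> within {0..T})"
      by (auto intro!: derivative_eq_intros)
    show "grad V (x \<tau>) \<bullet> F (x \<tau>) + W y \<le> 0"
      using decrease[of "x \<tau>"] y_min[OF in_K[of \<tau>]] \<tau> by simp
  qed
  have V_nonneg: "0 \<le> V v" for v using V_pos[of v] V_zero by (cases "v = z") auto
  \<comment> \<open>A time at which the linear bound on \<open>V\<close> equals \<open>- W y < 0\<close>.\<close>
  define T where "T = V (x 0) / W y + 1"
  have T: "0 \<le> T" "W y * T = V (x 0) + W y"
    using pos V_nonneg[of "x 0"] by (auto simp: T_def field_simps)
  with bound[of T] V_nonneg[of "x T"] pos show False by simp
qed

text \<open>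
  Attraction: a solution starting close to \<open>z\<close> is bounded by stability, hence enters every
  neighbourhood of \<open>z\<close>; stability applied again from the time of entry keeps it close from then on.
\<close>
theorem asymptotically_stable: "asymptotically_stable F z"
proof -
  obtain \<delta> where "0 < \<delta>"
    and \<delta>: "\<And>x0. dist x0 z < \<delta> \<Longrightarrow> solution_satisfies F x0 (\<lambda>x. \<forall>\<tau>\<ge>0. dist (x \<tau>) z < 1)"
    using lyapunov_stable zero_less_one unfolding lyapunov_stable_def by blast
  have "(x \<longlongrightarrow> z) at_top" if x0: "dist x0 z < \<delta>" and x: "solution_from F x0 x" for x0 x
  proof (rule tendstoI)
    fix \<epsilon> :: real assume "0 < \<epsilon>"
    then obtain \<eta> where "0 < \<eta>"
      and \<eta>: "\<And>y. dist y z < \<eta> \<Longrightarrow> solution_satisfies F y (\<lambda>x. \<forall>\<tau>\<ge>0. dist (x \<tau>) z < \<epsilon>)"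
      using lyapunov_stable unfolding lyapunov_stable_def by blast
    have "dist (x \<tau>) z \<le> 1" if "0 \<le> \<tau>" for \<tau>
      using \<delta>[OF x0] x that unfolding solution_satisfies_def by force
    from visits_neighbourhood[OF x this \<open>0 < \<eta>\<close>]
    obtain T where T: "0 \<le> T" "dist (x T) z < \<eta>" by blast
    have "dist (x (T + \<tau>)) z < \<epsilon>" if "0 \<le> \<tau>" for \<tau>
      using \<eta>[OF T(2)] solution_from_shift[OF x T(1)] that
      unfolding solution_satisfies_def by blast
    then have "dist (x \<tau>) z < \<epsilon>" if "T \<le> \<tau>" for \<tau>
      using that by (metis add.commute diff_add_cancel diff_ge_0_iff_ge)
    then show "\<forall>\<^sub>F \<tau> in at_top. dist (x \<tau>) z < \<epsilon>"
      by (auto simp: eventually_at_top_linorder)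
  qed
  then have "\<forall>x0. dist x0 z < \<delta> \<longrightarrow> solution_satisfies F x0 (\<lambda>x. (x \<longlongrightarrow> z) at_top)"
    using \<delta> unfolding solution_satisfies_def by blast
  with \<open>0 < \<delta>\<close> show ?thesis
    unfolding asymptotically_stable_def using equilibrium lyapunov_stable by blast
qed

end

section \<open>Barrier functions\<close>

text \<open>
  Gronwall's argument with the integrating factor \<open>exp A\<close>, where \<open>A\<close> is a primitive of \<open>c\<close> along the
  solution. This factor is positive whatever the sign of \<open>c\<close>, which is why the
  multiplier of \<open>B\<close> in a barrier certificate may be an arbitrary polynomial.
\<close>
lemma barrier_nonpos:
  assumes "0 \<le> T" and x: "solution_upto T F x"
    and B: "\<And>y. B differentiable at y"
    and ineq: "\<And>y. grad B y \<bullet> F y \<le> - c y * B y"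
    and c: "continuous_on UNIV c"
    and init: "B (x 0) \<le> 0"
  shows "B (x T) \<le> 0"
proof -
  define A where "A \<tau> = integral {0..\<tau>} (\<lambda>s. c (x s))" for \<tau>
  have "continuous_on {0..T} (\<lambda>s. c (x s))"
    by (rule continuous_on_compose2[OF c solution_upto_continuous[OF x]]) auto
  then have A: "(A has_real_derivative c (x \<tau>)) (at \<tau> within {0..T})" if "\<tau> \<in> {0..T}" for \<tau>
    unfolding A_def has_real_derivative_iff_has_vector_derivative
    by (intro integral_has_vector_derivative that)
  have "B (x T) * exp (A T) \<le> B (x 0) * exp (A 0)"
  proof (rule le_initial_if_derivative_nonpos[OF \<open>0 \<le> T\<close>])
    fix \<tau> assume \<tau>: "\<tau> \<in> {0..T}"
    have "((\<lambda>s. B (x s)) has_real_derivative grad B (x \<tau>) \<bullet> F (x \<tau>)) (at \<tau> within {0..T})"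
      using x \<tau> by (intro has_real_derivative_along_curve B) (auto simp: solution_upto_def)
    from this A[OF \<tau>]
    show "((\<lambda>s. B (x s) * exp (A s)) has_real_derivative
        (grad B (x \<tau>) \<bullet> F (x \<tau>) + c (x \<tau>) * B (x \<tau>)) * exp (A \<tau>)) (at \<tau> within {0..T})"
      by (auto intro!: derivative_eq_intros simp: algebra_simps)
    show "(grad B (x \<tau>) \<bullet> F (x \<tau>) + c (x \<tau>) * B (x \<tau>)) * exp (A \<tau>) \<le> 0"
      using ineq[of "x \<tau>"] by (intro mult_nonpos_nonneg) auto
  qed
  also have "\<dots> \<le> 0" using init by (simp add: A_def)
  finally show ?thesis by (simp add: mult_le_0_iff not_le)
qed

text \<open>
  Each \<open>B i\<close> stays nonpositive by itself, so the intersection confines the solutions; compactness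
  of the intersection then yields their existence for all times.
\<close>
theorem sublevel_intersection_forward_invariant:
  fixes F :: "real ^ 'n \<Rightarrow> real ^ 'n"
  assumes lip: "\<And>R. \<exists>L. L-lipschitz_on (cball 0 R) F"
    and B: "\<And>i y. i \<in> I \<Longrightarrow> B i differentiable at y"
    and c: "\<And>i. i \<in> I \<Longrightarrow> continuous_on UNIV (c i)"
    and ineq: "\<And>i y. i \<in> I \<Longrightarrow> grad (B i) y \<bullet> F y \<le> - c i y * B i y"
    and compact: "compact (\<Inter>i\<in>I. {y. B i y \<le> 0})"
  shows "forward_invariant F (\<Inter>i\<in>I. {y. B i y \<le> 0})"
  unfolding forward_invariant_def solution_satisfies_def
proof (intro ballI conjI allI impI)
  let ?X = "\<Inter>i\<in>I. {y. B i y \<le> 0}"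
  fix x0 assume x0: "x0 \<in> ?X"
  have confined: "x T \<in> ?X" if "0 \<le> T" "x 0 = x0" "solution_upto T F x" for T x
    using barrier_nonpos[OF that(1,3) B ineq c] x0 that(2) by auto
  show "\<exists>x. solution_from F x0 x"
    by (rule confined_solution_exists[where K = ?X]) (fact lip compact confined)+
  show "x \<tau> \<in> ?X" if x: "solution_from F x0 x" and \<tau>: "0 \<le> \<tau>" for x \<tau>
    by (rule confined[OF \<tau> _ solution_upto_if_solution_from[OF x]])
      (use x in \<open>simp add: solution_from_def\<close>)
qed

section \<open>Rational feedback is Lipschitz on compact sets\<close>

lemma lipschitz_on_mult_compact:
  fixes g h :: "'a::metric_space \<Rightarrow> real"
  assumes S: "compact S" and g: "M-lipschitz_on S g" and h: "N-lipschitz_on S h"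
  shows "\<exists>L. L-lipschitz_on S (\<lambda>x. g x * h x)"
proof -
  have "bounded (g ` S)" "bounded (h ` S)"
    by (intro compact_imp_bounded compact_continuous_image lipschitz_on_continuous_on S g h;
        fact g h)+
  then obtain a b where a: "0 < a" "\<And>x. x \<in> S \<Longrightarrow> \<bar>g x\<bar> \<le> a"
    and b: "0 < b" "\<And>x. x \<in> S \<Longrightarrow> \<bar>h x\<bar> \<le> b"
    by (auto simp: bounded_pos)
  have "(a * N + b * M)-lipschitz_on S (\<lambda>x. g x * h x)"
  proof (rule lipschitz_onI)
    show "0 \<le> a * N + b * M"
      using a b lipschitz_on_nonneg[OF g] lipschitz_on_nonneg[OF h] by simp
    fix x y assume xy: "x \<in> S" "y \<in> S"
    have "\<bar>g x * h x - g y * h y\<bar> = \<bar>g x * (h x - h y) + h y * (g x - g y)\<bar>"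
      by (simp add: algebra_simps)
    also have "\<dots> \<le> \<bar>g x\<bar> * \<bar>h x - h y\<bar> + \<bar>h y\<bar> * \<bar>g x - g y\<bar>"
      by (metis abs_mult abs_triangle_ineq)
    also have "\<dots> \<le> a * (N * dist x y) + b * (M * dist x y)"
      using a b xy lipschitz_onD[OF g xy] lipschitz_onD[OF h xy]
      by (intro add_mono mult_mono) (auto simp: dist_real_def)
    finally show "dist (g x * h x) (g y * h y) \<le> (a * N + b * M) * dist x y"
      by (simp add: dist_real_def algebra_simps)
  qed
  then show ?thesis by blast
qed

lemma lipschitz_on_inverse_pos:
  fixes g :: "'a::metric_space \<Rightarrow> real"
  assumes S: "compact S" and g: "M-lipschitz_on S g" and pos: "\<And>x. 0 < g x"
  shows "\<exists>L. L-lipschitz_on S (\<lambda>x. inverse (g x))"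
proof (cases "S = {}")
  case False
  then obtain z where z: "\<And>x. x \<in> S \<Longrightarrow> g z \<le> g x"
    using continuous_attains_inf[OF S _ lipschitz_on_continuous_on[OF g]] by blast
  have "(M / (g z)\<^sup>2)-lipschitz_on S (\<lambda>x. inverse (g x))"
  proof (rule lipschitz_onI)
    show "0 \<le> M / (g z)\<^sup>2" using lipschitz_on_nonneg[OF g] by simp
    fix x y assume xy: "x \<in> S" "y \<in> S"
    have "\<bar>inverse (g x) - inverse (g y)\<bar> = \<bar>g x - g y\<bar> / (g x * g y)"
      using pos[of x] pos[of y]
      by (simp add: divide_simps abs_mult abs_minus_commute)
    also have "\<dots> \<le> (M * dist x y) / (g z * g z)"
      using lipschitz_onD[OF g xy] z xy pos[of z] lipschitz_on_nonneg[OF g]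
      by (intro frac_le mult_mono) (auto simp: dist_real_def intro: less_imp_le[OF pos])
    finally show "dist (inverse (g x)) (inverse (g y)) \<le> M / (g z)\<^sup>2 * dist x y"
      by (simp add: dist_real_def power2_eq_square)
  qed
  then show ?thesis by blast
qed (auto intro: exI[of _ 0])

lemma real_polynomial_function_lipschitz:
  assumes "real_polynomial_function g" and "compact S"
  shows "\<exists>L. L-lipschitz_on S g"
  using assms(1)
proof induction
  case (linear g)
  then show ?case by (metis bounded_linear.lipschitz_boundE)
next
  case (const c)
  show ?case by (blast intro: lipschitz_on_constant)
next
  case (add g h)
  then show ?case by (blast intro: lipschitz_on_add)
next
  case (mult g h)
  then show ?case using lipschitz_on_mult_compact[OF assms(2)] by blast
qed

lemma lipschitz_on_componentwise:
  fixes F :: "'a::metric_space \<Rightarrow> real ^ 'n"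
  assumes "\<And>i. \<exists>L. L-lipschitz_on S (\<lambda>x. F x $ i)"
  shows "\<exists>L. L-lipschitz_on S F"
proof -
  obtain L where L: "\<And>i. (L i)-lipschitz_on S (\<lambda>x. F x $ i)" using assms by metis
  have "(\<Sum>i\<in>UNIV. L i)-lipschitz_on S F"
  proof (rule lipschitz_onI)
    show "0 \<le> (\<Sum>i\<in>UNIV. L i)" by (intro sum_nonneg lipschitz_on_nonneg[OF L])
    fix x y assume "x \<in> S" "y \<in> S"
    have "dist (F x) (F y) \<le> (\<Sum>i\<in>UNIV. \<bar>F x $ i - F y $ i\<bar>)"
      using norm_le_l1_cart[of "F x - F y"] by (simp add: dist_norm)
    also have "\<dots> \<le> (\<Sum>i\<in>UNIV. L i * dist x y)"
      using lipschitz_onD[OF L \<open>x \<in> S\<close> \<open>y \<in> S\<close>] by (intro sum_mono) (simp add: dist_real_def)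
    finally show "dist (F x) (F y) \<le> (\<Sum>i\<in>UNIV. L i) * dist x y"
      by (simp add: sum_distrib_right)
  qed
  then show ?thesis by blast
qed

lemma lipschitz_on_sum:
  fixes g :: "'i \<Rightarrow> 'a::metric_space \<Rightarrow> 'b::real_normed_vector"
  assumes "finite I" "\<And>i. i \<in> I \<Longrightarrow> \<exists>L. L-lipschitz_on S (g i)"
  shows "\<exists>L. L-lipschitz_on S (\<lambda>x. \<Sum>i\<in>I. g i x)"
  using assms
proof (induction rule: finite_induct)
  case empty
  show ?case by (auto intro: lipschitz_on_constant)
next
  case (insert i I)
  then obtain M N where "M-lipschitz_on S (g i)" "N-lipschitz_on S (\<lambda>x. \<Sum>i\<in>I. g i x)" by blast
  from lipschitz_on_add[OF this] insert.hyps show ?case by auto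
qed

lemma polynomial_function_nth:
  fixes p :: "real ^ 'n \<Rightarrow> 'b::real_normed_vector ^ 'k"
  assumes "polynomial_function p"
  shows "polynomial_function (\<lambda>x. p x $ i)"
  using polynomial_function_compose[OF assms
      polynomial_function_bounded_linear[OF bounded_linear_vec_nth[of i]]]
  by (simp add: o_def)

lemma closed_loop_lipschitz:
  fixes f :: "real ^ 'n \<Rightarrow> real ^ 'n" and G :: "real ^ 'n \<Rightarrow> real ^ 'm ^ 'n"
  assumes f: "polynomial_function f" and G: "polynomial_function G"
    and p: "polynomial_function p" and s: "real_polynomial_function s"
    and pos: "\<And>x. 0 < s x" and u: "\<And>x. u x = p x /\<^sub>R s x"
    and S: "compact S"
  shows "\<exists>L. L-lipschitz_on S (closed_loop f G u)"
proof (rule lipschitz_on_componentwise)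
  fix i
  note poly = real_polynomial_function_lipschitz[OF _ S, unfolded real_polynomial_function_eq]
  have "\<exists>L. L-lipschitz_on S (\<lambda>x. G x $ i $ j * (inverse (s x) * p x $ j))" for j
  proof -
    obtain a where a: "a-lipschitz_on S (\<lambda>x. G x $ i $ j)"
      using poly polynomial_function_nth[OF polynomial_function_nth[OF G]] by blast
    obtain b where b: "b-lipschitz_on S (\<lambda>x. p x $ j)"
      using poly polynomial_function_nth[OF p] by blast
    obtain c where "c-lipschitz_on S s"
      using real_polynomial_function_lipschitz[OF s S] by blast
    then obtain d where "d-lipschitz_on S (\<lambda>x. inverse (s x))"
      using lipschitz_on_inverse_pos[of S _ s] S pos by blast
    then obtain e where "e-lipschitz_on S (\<lambda>x. inverse (s x) * p x $ j)"
      using lipschitz_on_mult_compact[OF S _ b] by blast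
    then show ?thesis by (rule lipschitz_on_mult_compact[OF S a])
  qed
  then obtain M where M: "M-lipschitz_on S (\<lambda>x. \<Sum>j\<in>UNIV. G x $ i $ j * (inverse (s x) * p x $ j))"
    using lipschitz_on_sum[of UNIV S "\<lambda>j x. G x $ i $ j * (inverse (s x) * p x $ j)"] by auto
  obtain N where N: "N-lipschitz_on S (\<lambda>x. f x $ i)"
    using poly polynomial_function_nth[OF f] by blast
  from lipschitz_on_add[OF N M]
  show "\<exists>L. L-lipschitz_on S (\<lambda>x. closed_loop f G u x $ i)"
    by (auto simp: closed_loop_def u matrix_vector_mult_def)
qed

section \<open>Reading off the sum-of-squares certificates\<close>

lemma sos_nonneg: "sos q \<Longrightarrow> 0 \<le> q x"
  by (auto simp: sos_def intro!: sum_nonneg)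

lemma sos_polynomial:
  assumes "sos q"
  shows "real_polynomial_function q"
proof -
  obtain k :: nat and g where g: "\<forall>j<k. real_polynomial_function (g j)"
    and q: "\<forall>x. q x = (\<Sum>j<k. (g j x)\<^sup>2)"
    using assms unfolding sos_def by (elim exE conjE)
  from q have q': "q = (\<lambda>x. \<Sum>j<k. (g j x)\<^sup>2)" by (simp add: fun_eq_iff)
  show ?thesis
    unfolding q' using g
    by (intro real_polynomial_function_sum real_polynomial_function_power) auto
qed

text \<open>
  Along \<open>u = p / s\<close> the Lie derivative is the certified expression divided by \<open>s\<close>. The remainder
  \<open>r\<close> is \<open>l\<^sup>2\<close> for a Lyapunov certificate and \<open>q B\<close> for a barrier certificate. Since each
  certificate is divided by its own \<open>s\<close>, the certificates need to share only the quotient \<open>u\<close>.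
\<close>
lemma closed_loop_lie_derivative:
  assumes "u x = p x /\<^sub>R s x" "0 < s x"
    and "0 \<le> - s x * (grad V x \<bullet> f x) - grad V x \<bullet> (G x *v p x) - r"
  shows "grad V x \<bullet> closed_loop f G u x \<le> - r / s x"
proof -
  have "grad V x \<bullet> closed_loop f G u x
      = (s x * (grad V x \<bullet> f x) + grad V x \<bullet> (G x *v p x)) / s x"
    using assms(2)
    by (simp add: closed_loop_def assms(1) inner_add_right matrix_vector_mult_scaleR field_simps)
  also have "\<dots> \<le> - r / s x"
    using assms(2,3) by (intro divide_right_mono) auto
  finally show ?thesis .
qed

lemma continuous_on_polynomial_quotient:
  assumes "real_polynomial_function q" "real_polynomial_function s" "\<And>x. 0 < s x"
  shows "continuous_on S (\<lambda>x. q x / s x)"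
proof (rule continuous_on_divide)
  show "continuous_on S q" "continuous_on S s"
    using assms by (auto simp: real_polynomial_function_eq intro: continuous_on_polymonial_function)
  show "\<forall>x\<in>S. s x \<noteq> 0" using assms(3) by (metis less_irrefl)
qed

section \<open>Stability and safety under control sharing\<close>

theorem proposition4:
  fixes f :: "real ^ 'n \<Rightarrow> real ^ 'n"
    and G :: "real ^ 'n \<Rightarrow> real ^ 'm ^ 'n"
    and xs :: "real ^ 'n"
    and t :: nat
    and w B :: "nat \<Rightarrow> real ^ 'n \<Rightarrow> real"
    and V :: "real ^ 'n \<Rightarrow> real"
    and u :: "real ^ 'n \<Rightarrow> real ^ 'm"
  assumes "polynomial_function f"
    and "polynomial_function G"
    and "t \<ge> 1"
    and "\<And>i. i \<in> {1..t} \<Longrightarrow> real_polynomial_function (w i)"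
    and "\<And>i. i \<in> {1..t} \<Longrightarrow> compact {x. w i x \<le> 0}"
    and "is_CLF f G xs V"
    and "\<And>i. i \<in> {1..t} \<Longrightarrow> is_CBF f G (B i)"
    and "control_sharing f G xs V t B u"
    and "\<And>i. i \<in> {1..t} \<Longrightarrow> {x. B i x \<le> 0} \<subseteq> {x. w i x \<le> 0}"
  shows "asymptotically_stable (closed_loop f G u) xs \<and>
         safe (closed_loop f G u)
           {x. \<forall>i\<in>{1..t}. w i x \<le> 0} (\<Inter>i\<in>{1..t}. {x. B i x \<le> 0})"
proof
  let ?F = "closed_loop f G u" and ?X = "\<Inter>i\<in>{1..t}. {x. B i x \<le> 0}"
  obtain p s l where p: "polynomial_function p" and s: "sos s" "\<And>x. 0 < s x"
    and l: "real_polynomial_function l" "l xs = 0" "\<And>x. x \<noteq> xs \<Longrightarrow> l x \<noteq> 0"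
    and cert: "sos (\<lambda>x. - s x * (grad V x \<bullet> f x) - grad V x \<bullet> (G x *v p x) - (l x)\<^sup>2)"
    and u: "\<And>x. u x = p x /\<^sub>R s x"
    using assms(8) unfolding control_sharing_def is_CLF_controller_def by blast
  have lip: "\<exists>L. L-lipschitz_on (cball 0 R) ?F" for R
    by (rule closed_loop_lipschitz[OF assms(1,2) p sos_polynomial[OF s(1)] s(2) u compact_cball])
  have V: "real_polynomial_function V" "V xs = 0" "\<And>x. x \<noteq> xs \<Longrightarrow> 0 < V x"
    using assms(6) by (auto simp: is_CLF_def)
  interpret strict_lyapunov ?F xs V "\<lambda>x. (l x)\<^sup>2 / s x"
  proof
    show "\<exists>L. L-lipschitz_on (cball 0 R) ?F" for R by (rule lip)
    show "V differentiable at x" for x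
      by (rule differentiable_at_real_polynomial_function[OF V(1)])
    show "V xs = 0" by (rule V(2))
    show "0 < V x" if "x \<noteq> xs" for x by (rule V(3)[OF that])
    show "continuous_on UNIV (\<lambda>x. (l x)\<^sup>2 / s x)"
      by (rule continuous_on_polynomial_quotient[OF real_polynomial_function_power[OF l(1)]
            sos_polynomial[OF s(1)] s(2)])
    show "grad V x \<bullet> ?F x \<le> - ((l x)\<^sup>2 / s x)" for x
      using closed_loop_lie_derivative[of u x s p V f G "(l x)\<^sup>2"] u s(2) sos_nonneg[OF cert, of x]
      by simp
    show "0 \<le> (l x)\<^sup>2 / s x" for x using s(2)[of x] by simp
    show "0 < (l x)\<^sup>2 / s x" if "x \<noteq> xs" for x using s(2)[of x] l(3)[OF that] by simp
  qed
  show "asymptotically_stable ?F xs" by (rule asymptotically_stable)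

  have B: "real_polynomial_function (B i)" if "i \<in> {1..t}" for i
    using assms(7)[OF that] by (simp add: is_CBF_def)
  have "\<exists>c. continuous_on UNIV c \<and> (\<forall>x. grad (B i) x \<bullet> ?F x \<le> - c x * B i x)"
    if i: "i \<in> {1..t}" for i
  proof -
    obtain p' s' q where s': "sos s'" "\<And>x. 0 < s' x" and q: "real_polynomial_function q"
      and cert': "sos (\<lambda>x. - s' x * (grad (B i) x \<bullet> f x) - grad (B i) x \<bullet> (G x *v p' x) - q x * B i x)"
      and u': "\<And>x. u x = p' x /\<^sub>R s' x"
      using assms(8) i unfolding control_sharing_def is_CBF_controller_def by blast
    have "continuous_on UNIV (\<lambda>x. q x / s' x)"
      by (rule continuous_on_polynomial_quotient[OF q sos_polynomial[OF s'(1)] s'(2)])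
    moreover have "grad (B i) x \<bullet> ?F x \<le> - (q x / s' x) * B i x" for x
      using closed_loop_lie_derivative[of u x s' p' "B i" f G "q x * B i x"] u' s'(2)
        sos_nonneg[OF cert', of x] by simp
    ultimately show ?thesis by blast
  qed
  then obtain c where c: "\<And>i. i \<in> {1..t} \<Longrightarrow> continuous_on UNIV (c i)"
    and ineq: "\<And>i x. i \<in> {1..t} \<Longrightarrow> grad (B i) x \<bullet> ?F x \<le> - c i x * B i x"
    by metis
  have "closed {x. B i x \<le> 0}" if "i \<in> {1..t}" for i
    using B[OF that] by (intro closed_Collect_le continuous_on_const continuous_on_polymonial_function)
      (simp add: real_polynomial_function_eq)
  then have "closed ?X" by blast
  moreover have "?X \<subseteq> {x. w 1 x \<le> 0}" using assms(3,9) by force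
  ultimately have "compact ?X"
    using compact_Int_closed[of "{x. w 1 x \<le> 0}" ?X] assms(3,5) by (simp add: Int_absorb1)
  with lip _ c ineq have "forward_invariant ?F ?X"
    by (rule sublevel_intersection_forward_invariant)
      (rule differentiable_at_real_polynomial_function[OF B])
  then show "safe ?F {x. \<forall>i\<in>{1..t}. w i x \<le> 0} ?X"
    using assms(9) unfolding safe_def by blast
qed

end
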